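(* With $\Lambda(\mathcal{O}_i)$ denoting the spectrum of the overlapped property $\mathcal{O}_i$ (a set of pairs $(\omega,p)$), one has: (1) $\Lambda(\mathcal{O}_1)=((\mathrm{T}1.3\sqcup\mathrm{T}2.2)\times\Gamma_b)\sqcup(\mathrm{T}2.3\times\mathbb{N})$; (2) $\Lambda(\mathcal{O}_2)=\mathrm{T}2.3\times\mathbb{N}$; (3) the set of factors $\omega$ with $\omega\in\mathcal{O}_\infty$ is $\mathrm{T}2.3$. Here $\sqcup$ denotes disjoint union.
   Context: Words are over $\{a,b\}$; $\varepsilon$ is the empty word, $|\omega|$ the length. Let $\sigma(a)=ab$, $\sigma(b)=a$, $F_k=\sigma^k(a)$ for $k\ge0$, and $F_\infty=\lim_{k\to\infty}F_k$ (Fibonacci sequence), with $F_\infty[p]$ its $p$-th letter, $p\in\mathbb{N}=\{1,2,\dots\}$. Let $f_{-1}=f_0=1$, $f_{k+1}=f_k+f_{k-1}$, so $|F_k|=f_k$. For $k\ge0$ let $\alpha$ be the last letter of $F_k$ and $\beta$ the other letter; the singular words are $s_{-1}=a$ and $s_k=\beta F_k\alpha^{-1}$ for $k\ge0$ (delete the last letter of $F_k$ and prepend $\beta$). Throughout, $\omega$ ranges over the factors of $F_\infty$ with $\omega\notin\{\varepsilon,ab,ba,aba\}$; for such $\omega$ the singular kernel $sk(\omega)$, the longest singular word that is a factor of $\omega$, is well defined. Types: for such $\omega$ let $k\ge0$ be the unique integer with $f_k\le|\omega|<f_{k+1}$. Then $\omega\in\mathrm{T}1.j$ iff $|\omega|=f_k$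 and $sk(\omega)=s_{k-j+1}$, and $\omega\in\mathrm{T}2.j$ iff $f_k<|\omega|<f_{k+1}$ and $sk(\omega)=s_{k-j+1}$, for $j=1,2,3$ (for $j=3$ only $k\ge1$ is considered). $\omega_p$ denotes the $p$-th occurrence of $\omega$ in $F_\infty$ ($p\ge1$). Write $\omega_p\in\mathcal{O}_i$ ($i\ge1$) if for each $0\le t<i$ the consecutive occurrences $\omega_{p+t}$ and $\omega_{p+t+1}$ overlap in at least one position of $F_\infty$. Write $\omega\in\mathcal{O}_i$ if $\omega_p\in\mathcal{O}_i$ for some $p$, and $\omega\in\mathcal{O}_\infty$ if $\omega\in\mathcal{O}_i$ for all $i\ge1$. The spectrum is $\Lambda(\mathcal{O}_i)=\{(\omega,p): p\in\mathbb{N},\ \omega_p\in\mathcal{O}_i\}$. $\Gamma_b=\{p: F_\infty[p]=b\}$. *)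

theory Defs
  imports "HOL-Number_Theory.Fib" "HOL-Library.Sublist" "HOL-Library.Infinite_Set"
begin

datatype letter = La | Lb

type_synonym word = "letter list"

fun other :: "letter \<Rightarrow> letter" where
  "other La = Lb"
| "other Lb = La"

fun sigma_letter :: "letter \<Rightarrow> word" where
  "sigma_letter La = [La, Lb]"
| "sigma_letter Lb = [La]"

definition sigma :: "word \<Rightarrow> word" where
  "sigma w = concat (map sigma_letter w)"

definition fib_word :: "nat \<Rightarrow> word" where
  "fib_word k = (sigma ^^ k) [La]"

text \<open>Positions in the infinite word are counted from 1, so \<open>fib_seq 0\<close> carries no meaning and
  every use below restricts to positions at least 1.\<close>

definition fib_seq :: "nat \<Rightarrow> letter" where
  "fib_seq p = (THE c. \<forall>\<^sub>F k in sequentially. p \<le> length (fib_word k) \<and> fib_word k ! (p - 1) = c)"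

text \<open>The numbering \<open>f\<^sub>-\<^sub>1 = f\<^sub>0 = 1\<close>, \<open>f\<^sub>k\<^sub>+\<^sub>1 = f\<^sub>k + f\<^sub>k\<^sub>-\<^sub>1\<close>
  is a shift by two of the library's \<open>fib\<close>; only \<open>k \<ge> -1\<close> is meaningful.\<close>

definition fib_len :: "int \<Rightarrow> nat" where
  "fib_len k = fib (nat (k + 2))"

lemma fib_len_minus_1: "fib_len (-1) = 1"
  by (simp add: fib_len_def)

lemma fib_len_0: "fib_len 0 = 1"
  by (simp add: fib_len_def numeral_2_eq_2)

lemma fib_len_rec: "k \<ge> 0 \<Longrightarrow> fib_len (k + 1) = fib_len k + fib_len (k - 1)"
proof -
  assume "k \<ge> 0"
  then have "nat (k + 1 + 2) = Suc (Suc (nat (k - 1 + 2)))" "nat (k + 2) = Suc (nat (k - 1 + 2))"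
    by linarith+
  then show ?thesis
    by (simp only: fib_len_def fib.simps)
qed

text \<open>Singular words are indexed by integers \<open>k \<ge> -1\<close>; the value for \<open>k < -1\<close> is meaningless.\<close>

definition sing_word :: "int \<Rightarrow> word" where
  "sing_word k =
     (if k = -1 then [La]
      else other (last (fib_word (nat k))) # butlast (fib_word (nat k)))"

definition singular_words :: "word set" where
  "singular_words = {sing_word k | k. k \<ge> -1}"

definition occurs_at :: "word \<Rightarrow> nat \<Rightarrow> bool" where
  "occurs_at w q \<longleftrightarrow> q \<ge> 1 \<and> (\<forall>i<length w. fib_seq (q + i) = w ! i)"

definition fib_factors :: "word set" where
  "fib_factors = {w. \<exists>q. occurs_at w q}"

definition admissible :: "word set" where
  "admissible = fib_factors - {[], [La, Lb], [Lb, La], [La, Lb, La]}"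

definition sing_kernel :: "word \<Rightarrow> word" where
  "sing_kernel w =
     (THE v. v \<in> singular_words \<and> sublist v w \<and>
        (\<forall>u\<in>singular_words. sublist u w \<longrightarrow> length u \<le> length v))"

text \<open>In both types, \<open>k\<close> is determined uniquely by its bounds. The condition
  \<open>int k - int j + 1 \<ge> -1\<close> keeps the index of the singular word in range; for \<open>j = 1, 2\<close> it always
  holds and for \<open>j = 3\<close> it says \<open>k \<ge> 1\<close>.\<close>

definition T1 :: "nat \<Rightarrow> word set" where
  "T1 j = {w \<in> admissible. \<exists>k::nat.
     fib_len (int k) \<le> length w \<and> length w < fib_len (int k + 1) \<and>
     length w = fib_len (int k) \<and>
     int k - int j + 1 \<ge> -1 \<and> sing_kernel w = sing_word (int k - int j + 1)}"

definition T2 :: "nat \<Rightarrow> word set" where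
  "T2 j = {w \<in> admissible. \<exists>k::nat.
     fib_len (int k) \<le> length w \<and> length w < fib_len (int k + 1) \<and>
     fib_len (int k) < length w \<and>
     int k - int j + 1 \<ge> -1 \<and> sing_kernel w = sing_word (int k - int j + 1)}"

text \<open>\<open>occ w p\<close> is the starting position of the \<open>p\<close>-th occurrence of \<open>w\<close>, for \<open>p \<ge> 1\<close>;
  \<open>enumerate\<close> counts from 0.\<close>

definition occ :: "word \<Rightarrow> nat \<Rightarrow> nat" where
  "occ w p = enumerate {q. occurs_at w q} (p - 1)"

definition occ_positions :: "word \<Rightarrow> nat \<Rightarrow> nat set" where
  "occ_positions w p = {occ w p ..< occ w p + length w}"

definition overlap_occ :: "nat \<Rightarrow> word \<Rightarrow> nat \<Rightarrow> bool" where
  "overlap_occ i w p \<longleftrightarrow>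
     (\<forall>t<i. occ_positions w (p + t) \<inter> occ_positions w (p + t + 1) \<noteq> {})"

definition overlap :: "nat \<Rightarrow> word \<Rightarrow> bool" where
  "overlap i w \<longleftrightarrow> (\<exists>p\<ge>1. overlap_occ i w p)"

definition overlap_inf :: "word \<Rightarrow> bool" where
  "overlap_inf w \<longleftrightarrow> (\<forall>i\<ge>1. overlap i w)"

definition spectrum :: "nat \<Rightarrow> (word \<times> nat) set" where
  "spectrum i = {(w, p). w \<in> admissible \<and> p \<ge> 1 \<and> overlap_occ i w p}"

definition Gamma_b :: "nat set" where
  "Gamma_b = {p. p \<ge> 1 \<and> fib_seq p = Lb}"

end

theory Submission
  imports Defs
begin

text \<open>Everything rests on one structural fact: for an admissible word \<open>w\<close> the gaps between
  consecutive occurrences take only two values, and the \<open>p\<close>-th gap is the long one or the short one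
  according as the \<open>p\<close>-th letter of the infinite word is \<open>a\<close> or \<open>b\<close>. If \<open>s\<^sub>m\<close> is the singular
  kernel of \<open>w\<close>, these values are \<open>f\<^sub>m\<^sub>+\<^sub>2\<close> and \<open>f\<^sub>m\<^sub>+\<^sub>1\<close>. Two consecutive occurrences overlap iff the gap
  is smaller than \<open>|w|\<close>. So all pairs overlap if \<open>|w| > f\<^sub>m\<^sub>+\<^sub>2\<close>, exactly those at a letter \<open>b\<close> overlap if
  \<open>f\<^sub>m\<^sub>+\<^sub>1 < |w| \<le> f\<^sub>m\<^sub>+\<^sub>2\<close>, and none otherwise. Written in terms of lengths, the first range is
  T2.3 and the second is the union of T1.3 (equality) and T2.2 (strict inequality). Since \<open>bb\<close> is not a
  factor, two successive overlaps already force the first range, which settles the second and the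
  third claim.

  To find the gaps, let \<open>S x\<close> be the place where the image of the letter at \<open>x\<close> starts when the
  infinite word is read as its own image under \<open>\<sigma>\<close> (\<open>block_start\<close>). The infinite word is cut by the numbers
  \<open>S\<^sup>n x\<close> into blocks \<open>\<sigma>\<^sup>n(a)\<close> and \<open>\<sigma>\<^sup>n(b)\<close>, arranged like its letters, so the differences
  of \<open>S\<^sup>n\<close> are two Fibonacci numbers distributed like \<open>a\<close> and \<open>b\<close>. Two observations link this with
  kernels. First, \<open>\<sigma>\<close> carries each singular word to the next, up to one letter \<open>a\<close>, and it can be
  undone uniquely; hence the occurrences of \<open>s\<^sub>m\<close> are the numbers \<open>S\<^sup>m\<^sup>+\<^sup>2 x\<close> shifted by a constant
  (lemma \<open>reads_sing_iff\<close>). Second, a window of length \<open>f\<^sub>m\<^sub>+\<^sub>3 - 2\<close> around each occurrence of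
  \<open>s\<^sub>m\<close> always shows the same central word (lemma \<open>reads_central\<close>), whereas a word that contains
  \<open>s\<^sub>m\<close> and leaves its window contains \<open>s\<^sub>m\<^sub>+\<^sub>1\<close> or \<open>s\<^sub>m\<^sub>+\<^sub>2\<close> (lemmas
  \<open>longer_sing_left_of_window\<close> and \<open>longer_sing_right_of_window\<close>). A word with kernel \<open>s\<^sub>m\<close> therefore
  sits inside the window and occurs exactly where \<open>s\<^sub>m\<close> does, up to a fixed shift.\<close>

section \<open>The fixed point of the substitution\<close>

lemma sigma_Nil [simp]: "sigma [] = []"
  and sigma_Cons [simp]: "sigma (c # w) = sigma_letter c @ sigma w"
  and sigma_append [simp]: "sigma (u @ v) = sigma u @ sigma v"
  by (simp_all add: sigma_def)

lemma fib_word_Suc: "fib_word (Suc k) = sigma (fib_word k)"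
  by (simp add: fib_word_def)

lemma fib_word_rec: "fib_word (Suc (Suc k)) = fib_word (Suc k) @ fib_word k"
  by (induction k) (simp_all add: fib_word_def)

lemma length_fib_word: "length (fib_word k) = fib (k + 2)"
proof (induction k rule: fib.induct)
  case (3 k)
  then show ?case by (simp add: fib_word_rec)
qed (simp_all add: fib_word_def eval_nat_numeral)

lemma fib_word_mono: "k \<le> l \<Longrightarrow> prefix (fib_word k) (fib_word l)"
proof (induction l rule: dec_induct)
  case (step l)
  have "prefix (fib_word l) (fib_word (Suc l))"
    by (cases l) (simp_all add: fib_word_rec, simp add: fib_word_def)
  with step show ?case by (metis prefix_order.trans)
qed simp

lemma le_fib: "n \<le> fib (Suc n)"
proof (induction n rule: fib.induct)
  case (3 n)
  then show ?case using fib_neq_0_nat[of "Suc n"] by (cases n) auto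
qed auto

text \<open>Counting positions from 0 makes the image of the prefix of length \<open>x\<close> a prefix whose length is
  the position of the next block.\<close>

definition letter_at :: "nat \<Rightarrow> letter" where
  "letter_at i = fib_seq (Suc i)"

lemma letter_at_eq:
  assumes "i < length (fib_word k)"
  shows "letter_at i = fib_word k ! i"
proof -
  have nth: "i < length (fib_word l) \<and> fib_word l ! i = fib_word k ! i" if "k \<le> l" for l
    using fib_word_mono[OF that] assms by (auto simp: prefix_def nth_append)
  have ev: "\<forall>\<^sub>F l in sequentially. Suc i \<le> length (fib_word l) \<and> fib_word l ! i = fib_word k ! i"
    unfolding eventually_sequentially Suc_le_eq using nth by blast
  show ?thesis
    unfolding letter_at_def fib_seq_def diff_Suc_1
  proof (rule the_equality)
    show "\<forall>\<^sub>F l in sequentially. Suc i \<le> length (fib_word l) \<and> fib_word l ! i = fib_word k ! i"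
      by (fact ev)
  next
    fix c
    assume "\<forall>\<^sub>F l in sequentially. Suc i \<le> length (fib_word l) \<and> fib_word l ! i = c"
    with ev have "\<forall>\<^sub>F l in sequentially. c = fib_word k ! i"
      by eventually_elim auto
    then show "c = fib_word k ! i" by simp
  qed
qed

primrec block_start :: "nat \<Rightarrow> nat" where
  "block_start 0 = 0"
| "block_start (Suc x) = block_start x + length (sigma_letter (letter_at x))"

text \<open>This is the fixed-point equation of the infinite word, letter by letter: the block that starts at
  \<open>block_start x\<close> is the image of the letter at \<open>x\<close>. It is read off a finite prefix
  \<open>fib_word x\<close> long enough to contain position \<open>x\<close>, whose image is again a prefix.\<close>

lemma block_reads:
  shows letter_at_block_start: "letter_at (block_start x) = La"
    and letter_at_Suc_block_start:
      "letter_at x = La \<Longrightarrow> letter_at (Suc (block_start x)) = Lb"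
proof -
  let ?F = "fib_word x"
  have len: "x < length ?F"
    using le_fib[of "Suc x"] by (simp add: length_fib_word)
  have take: "length (sigma (take y ?F)) = block_start y" if "y \<le> x" for y
    using that
  proof (induction y)
    case (Suc y)
    then have "y < length ?F" using len by simp
    with Suc show ?case by (simp add: take_Suc_conv_app_nth letter_at_eq)
  qed simp
  have "fib_word (Suc x) = sigma (take x ?F @ ?F ! x # drop (Suc x) ?F)"
    using len by (simp add: fib_word_Suc flip: id_take_nth_drop)
  then have F: "fib_word (Suc x)
      = sigma (take x ?F) @ sigma_letter (letter_at x) @ sigma (drop (Suc x) ?F)"
    using len by (simp add: letter_at_eq)
  show "letter_at (block_start x) = La"
    using take[of x] F
    by (cases "letter_at x") (auto simp: letter_at_eq[of _ "Suc x"] nth_append)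
  show "letter_at (Suc (block_start x)) = Lb" if "letter_at x = La"
    using take[of x] F that by (auto simp: letter_at_eq[of _ "Suc x"] nth_append)
qed

lemma block_cases:
  obtains (start) x where "y = block_start x"
  | (second) x where "y = Suc (block_start x)" "letter_at x = La"
proof -
  have "\<exists>x. y = block_start x \<or> y = Suc (block_start x) \<and> letter_at x = La"
  proof (induction y)
    case 0
    show ?case by (rule exI[of _ 0]) simp
  next
    case (Suc y)
    then obtain x where x: "y = block_start x \<or> y = Suc (block_start x) \<and> letter_at x = La"
      by blast
    show ?case
    proof (cases "letter_at x")
      case La
      with x show ?thesis
        by (metis add_Suc_right add_0_right block_start.simps(2) list.size(3,4)
            sigma_letter.simps(1))
    next
      case Lb
      with x have "Suc y = block_start (Suc x)" by simp
      then show ?thesis by blast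
    qed
  qed
  then show ?thesis using that by blast
qed

lemma letter_at_La_iff: "letter_at y = La \<longleftrightarrow> (\<exists>x. y = block_start x)"
  by (cases y rule: block_cases)
     (auto simp: letter_at_block_start letter_at_Suc_block_start,
      metis letter.distinct(1) letter_at_Suc_block_start letter_at_block_start)

text \<open>A letter \<open>b\<close> is the second letter of the image of an \<open>a\<close>, and that \<open>a\<close> starts a block itself.\<close>

lemma letter_at_Lb_E:
  assumes "letter_at y = Lb"
  obtains x where "y = Suc (block_start (block_start x))"
    "Suc y = block_start (Suc (block_start x))"
proof (cases y rule: block_cases)
  case (start x)
  then show ?thesis using assms letter_at_block_start by simp
next
  case (second z)
  then obtain x where "z = block_start x" by (auto simp: letter_at_La_iff)
  with second show ?thesis by (intro that[of x]) simp_all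
qed

lemma letter_at_Suc_block_start_iff:
  "letter_at (Suc (block_start x)) = Lb \<longleftrightarrow> letter_at x = La"
  using letter_at_Suc_block_start[of x] letter_at_block_start[of "Suc x"]
  by (cases "letter_at x") auto

lemma no_two_Lb: "letter_at x = Lb \<Longrightarrow> letter_at (Suc x) = La"
  by (metis letter_at_Lb_E letter_at_block_start)

text \<open>The difference is the length of the image of the letter at \<open>x\<close> under the \<open>n\<close>-th power of the
  substitution; it is the source of the gap lengths.\<close>

lemma pow_block_start_Suc:
  "(block_start ^^ n) (Suc x)
     = (block_start ^^ n) x + (if letter_at x = La then fib (n + 2) else fib (n + 1))"
proof (induction n arbitrary: x)
  case 0
  show ?case by (simp add: eval_nat_numeral)
next
  case (Suc n)
  show ?case
    by (cases "letter_at x")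
       (simp_all add: funpow_Suc_right Suc letter_at_block_start letter_at_Suc_block_start
         eval_nat_numeral del: funpow.simps)
qed


lemma strict_mono_pow_block_start: "strict_mono (block_start ^^ n)"
  by (simp add: strict_mono_Suc_iff pow_block_start_Suc fib_neq_0_nat)

lemma pow_block_start_0 [simp]: "(block_start ^^ n) 0 = 0"
  by (induction n) simp_all

section \<open>Occurrences of words and desubstitution\<close>

definition reads :: "word \<Rightarrow> nat \<Rightarrow> bool" where
  "reads w x \<longleftrightarrow> occurs_at w (Suc x)"

lemma reads_iff_nth: "reads w x \<longleftrightarrow> (\<forall>i<length w. letter_at (x + i) = w ! i)"
  by (simp add: reads_def occurs_at_def letter_at_def)

lemma reads_Nil [simp]: "reads [] x"
  by (simp add: reads_iff_nth)

lemma reads_Cons [simp]: "reads (c # w) x \<longleftrightarrow> letter_at x = c \<and> reads w (Suc x)"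
  by (auto simp: reads_iff_nth nth_Cons split: nat.splits)

lemma reads_append [simp]: "reads (u @ v) x \<longleftrightarrow> reads u x \<and> reads v (x + length u)"
  by (induction u arbitrary: x) auto

lemma reads_sublistE:
  assumes "reads w x" "sublist v w"
  obtains d where "reads v (x + d)" "d + length v \<le> length w"
proof -
  from assms(2) obtain us vs where "w = us @ v @ vs" by (auto simp: sublist_def)
  with assms(1) show ?thesis by (intro that[of "length us"]) auto
qed

lemma reads_eq_take_drop:
  assumes "reads u x" "reads v (x + d)" "d + length v \<le> length u"
  shows "v = take (length v) (drop d u)"
  using assms by (intro nth_equalityI) (auto simp: reads_iff_nth add.assoc)

lemma sublist_if_reads:
  assumes "reads u x" "reads v (x + d)" "d + length v \<le> length u"
  shows "sublist v u"
proof -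
  have "u = take d u @ v @ drop (length v) (drop d u)"
    using reads_eq_take_drop[OF assms] by (metis append_take_drop_id)
  then show ?thesis unfolding sublist_def by blast
qed

lemma reads_window:
  assumes "reads u x" "reads v (x + d)" "d + length v \<le> length u" "reads u y"
  shows "reads v (y + d)"
  using assms by (auto simp: reads_iff_nth add.assoc)

lemma length_sigma_if_reads:
  "reads u x \<Longrightarrow> block_start x + length (sigma u) = block_start (x + length u)"
proof (induction u arbitrary: x)
  case (Cons c u)
  then show ?case using Cons.IH[of "Suc x"] by (simp add: add.assoc)
qed simp

text \<open>The trailing \<open>a\<close> is what makes the image decodable: an \<open>a\<close> comes from \<open>a\<close> if \<open>b\<close>
  follows and from \<open>b\<close> if \<open>a\<close> follows, so knowing the next letter is necessary after a final \<open>a\<close>.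
  It costs nothing, because every block begins with \<open>a\<close>.\<close>

lemma reads_sigma_snoc:
  "reads (sigma u @ [La]) (block_start x) \<longleftrightarrow> reads u x"
proof (induction u arbitrary: x)
  case Nil
  show ?case by (simp add: letter_at_block_start)
next
  case (Cons c u)
  have b: "block_start (Suc x) = Suc (block_start x) + (if letter_at x = La then 1 else 0)"
    by (cases "letter_at x") auto
  show ?case
  proof (cases "c = letter_at x")
    case True
    with Cons[of "Suc x"] show ?thesis
      by (cases c) (auto simp: letter_at_block_start letter_at_Suc_block_start)
  next
    case False
    have "\<not> reads (sigma (c # u) @ [La]) (block_start x)"
    proof (cases c)
      case La
      with False have "letter_at (Suc (block_start x)) \<noteq> Lb"
        by (simp add: letter_at_Suc_block_start_iff)
      with La show ?thesis by simp
    next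
      case Lb
      with False have "letter_at (Suc (block_start x)) = Lb"
        by (cases "letter_at x") (simp_all add: letter_at_Suc_block_start)
      moreover have "hd (sigma u @ [La]) = La" "sigma u @ [La] \<noteq> []"
        by (cases u; cases "hd u"; simp)+
      ultimately show ?thesis
        using Lb by (cases "sigma u @ [La]") auto
    qed
    with False show ?thesis by simp
  qed
qed

lemma reads_sigma_snoc_iff:
  "reads (sigma u @ [La]) y \<longleftrightarrow> (\<exists>x. y = block_start x \<and> reads u x)"
proof
  assume r: "reads (sigma u @ [La]) y"
  have "hd (sigma u @ [La]) = La" "sigma u @ [La] \<noteq> []"
    by (cases u; cases "hd u"; simp)+
  with r have "letter_at y = La"
    by (cases "sigma u @ [La]") auto
  with r show "\<exists>x. y = block_start x \<and> reads u x"
    by (metis letter_at_La_iff reads_sigma_snoc)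
qed (metis reads_sigma_snoc)

text \<open>If the decoded word ends in \<open>a\<close>, its image ends in \<open>b\<close>, and no further letter is needed.\<close>

lemma reads_sigma_iff_if_last_La:
  "reads (sigma (u @ [La])) (block_start x) \<longleftrightarrow> reads (u @ [La]) x"
proof -
  have "sigma (u @ [La]) = (sigma u @ [La]) @ [Lb]" by simp
  then have "reads (sigma (u @ [La])) (block_start x)
      \<longleftrightarrow> reads u x \<and> letter_at (Suc (block_start x + length (sigma u))) = Lb"
    by (simp only: reads_append[of "sigma u @ [La]"] reads_sigma_snoc) simp
  also have "\<dots> \<longleftrightarrow> reads u x \<and> letter_at (x + length u) = La"
    using length_sigma_if_reads letter_at_Suc_block_start_iff by metis
  finally show ?thesis by simp
qed

section \<open>Central and singular words\<close>

text \<open>\<open>central n\<close> is the Fibonacci word \<open>F\<^sub>n\<^sub>+\<^sub>1\<close> without its last two letters. The recursion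
  matches the decodable shape \<open>\<sigma>(u)a\<close>, so that each step of it is one step of desubstitution.\<close>

primrec central :: "nat \<Rightarrow> word" where
  "central 0 = []"
| "central (Suc n) = sigma (central n) @ [La]"

text \<open>The index is shifted by one to make it a natural number: \<open>sing n\<close> is \<open>s\<^sub>n\<^sub>-\<^sub>1\<close>.\<close>

definition sing :: "nat \<Rightarrow> word" where
  "sing n = sing_word (int n - 1)"

lemma fib_word_central:
  "fib_word (Suc n) = central n @ (if even n then [La, Lb] else [Lb, La])"
proof (induction n)
  case 0
  show ?case by (simp add: fib_word_def)
next
  case (Suc n)
  then show ?case by (simp add: fib_word_Suc[of "Suc n"])
qed

lemma length_central: "length (central n) + 2 = fib (n + 3)"
  using arg_cong[OF fib_word_central[of n], of length]
  by (simp add: length_fib_word eval_nat_numeral)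

lemma sing_0: "sing 0 = [La]"
  and sing_1: "sing (Suc 0) = [Lb]"
  by (simp_all add: sing_def sing_word_def fib_word_def)

lemma sing_central:
  "sing (Suc (Suc n)) = (let c = (if even n then La else Lb) in c # central n @ [c])"
proof -
  have "int (Suc (Suc n)) - 1 = int (Suc n)" by simp
  then have "sing (Suc (Suc n)) = other (last (fib_word (Suc n))) # butlast (fib_word (Suc n))"
    by (simp only: sing_def sing_word_def nat_int) simp
  then show ?thesis
    by (simp add: fib_word_central butlast_append Let_def)
qed

lemma length_sing: "length (sing n) = fib (Suc n)"
proof -
  consider "n = 0" | "n = 1" | m where "n = Suc (Suc m)"
    by (metis One_nat_def old.nat.exhaust)
  then show ?thesis
  proof cases
    case 3
    with length_central[of m] show ?thesis
      by (simp add: sing_central Let_def eval_nat_numeral)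
  qed (simp_all add: sing_0 sing_1)
qed

text \<open>The passage to the next singular word loses no information about occurrences: an \<open>a\<close> appended
  to an image is the start of the next block, and an \<open>a\<close> removed before a \<open>b\<close> is forced.\<close>

lemma sing_Suc:
  shows sing_Suc_if_odd: "odd n \<Longrightarrow> sing (Suc n) = sigma (sing n) @ [La]"
    and sing_Suc_if_even: "even n \<Longrightarrow> La # sing (Suc n) = sigma (sing n)"
proof -
  consider "n = 0" | "n = 1" | m where "n = Suc (Suc m)"
    by (metis One_nat_def old.nat.exhaust)
  note cs = this
  show "sing (Suc n) = sigma (sing n) @ [La]" if "odd n"
    using cs that by cases (simp_all add: sing_0 sing_1 sing_central)
  show "La # sing (Suc n) = sigma (sing n)" if "even n"
    using cs that by cases (simp_all add: sing_0 sing_1 sing_central)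
qed

lemma hd_sing: "\<exists>w. sing n = (if even n then La else Lb) # w"
  and last_sing: "\<exists>w. sing n = w @ [if even n then La else Lb]"
proof -
  consider "n = 0" | "n = 1" | m where "n = Suc (Suc m)"
    by (metis One_nat_def old.nat.exhaust)
  note cs = this
  show "\<exists>w. sing n = (if even n then La else Lb) # w"
    using cs by cases (simp_all add: sing_0 sing_1 sing_central)
  show "\<exists>w. sing n = w @ [if even n then La else Lb]"
    using cs by cases (auto simp: sing_0 sing_1 sing_central Let_def intro: exI[of _ "_ # _"])
qed

text \<open>In both parities the place just after the first letter of the old occurrence is mapped to the
  place just after the first letter of the new one. This is why the successor of the position,
  rather than the position, follows \<open>block_start\<close> without a correction term.\<close>

lemma reads_sing_Suc_iff:
  "reads (sing (Suc n)) y \<longleftrightarrow> (\<exists>x. reads (sing n) x \<and> Suc y = block_start (Suc x))"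
proof (cases "even n")
  case False
  have "block_start (Suc x) = Suc (block_start x)" if "reads (sing n) x" for x
    using hd_sing[of n] that False by auto
  moreover have "reads (sing (Suc n)) y \<longleftrightarrow> (\<exists>x. y = block_start x \<and> reads (sing n) x)"
    by (simp only: sing_Suc_if_odd[OF False] reads_sigma_snoc_iff)
  ultimately show ?thesis by (metis Suc_inject)
next
  case True
  have La: "letter_at x = La" if "reads (sing n) x" for x
    using hd_sing[of n] that True by auto
  obtain v where v: "sing n = v @ [La]" using last_sing[of n] True by auto
  have step: "reads (sing (Suc n)) (Suc (block_start x)) \<longleftrightarrow> reads (sing n) x" for x
    using reads_sigma_iff_if_last_La[of v x] sing_Suc_if_even[OF True]
    by (metis v reads_Cons letter_at_block_start)
  show ?thesis
  proof
    assume r: "reads (sing (Suc n)) y"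
    have "letter_at y = Lb" using hd_sing[of "Suc n"] r True by auto
    then obtain x where "y = Suc (block_start x)" "letter_at x = La"
      by (cases y rule: block_cases) (simp_all add: letter_at_block_start)
    with r step show "\<exists>x. reads (sing n) x \<and> Suc y = block_start (Suc x)"
      by (auto intro!: exI[of _ x])
  next
    assume "\<exists>x. reads (sing n) x \<and> Suc y = block_start (Suc x)"
    then obtain x where x: "reads (sing n) x" "Suc y = block_start (Suc x)" by blast
    with La have "y = Suc (block_start x)" by simp
    with x step show "reads (sing (Suc n)) y" by simp
  qed
qed

lemma reads_sing_iff:
  "reads (sing n) y \<longleftrightarrow> (\<exists>x. Suc y = (block_start ^^ n) (Suc (block_start x)))"
proof (induction n arbitrary: y)
  case 0
  show ?case by (simp add: sing_0 letter_at_La_iff)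
next
  case (Suc n)
  have "reads (sing (Suc n)) y
      \<longleftrightarrow> (\<exists>q. (\<exists>x. Suc q = (block_start ^^ n) (Suc (block_start x))) \<and> Suc y = block_start (Suc q))"
    by (simp only: reads_sing_Suc_iff Suc)
  also have "\<dots> \<longleftrightarrow> (\<exists>x. Suc y = (block_start ^^ Suc n) (Suc (block_start x)))"
  proof -
    have "(block_start ^^ n) (Suc z) \<noteq> 0" for z
      using strict_mono_less[OF strict_mono_pow_block_start, of n 0 "Suc z"] by simp
    then have "\<exists>q. Suc q = (block_start ^^ n) (Suc z)" for z
      by (metis not0_implies_Suc)
    then show ?thesis by (metis comp_apply funpow.simps(2))
  qed
  finally show ?case .
qed

text \<open>This rewrites the positions in \<open>reads_sing_iff\<close> as block starts of level \<open>n + 1\<close> plus a constant.\<close>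

lemma pow_block_start_Suc_La:
  "(block_start ^^ n) (Suc (block_start x)) = (block_start ^^ Suc n) x + fib (n + 2)"
  by (simp add: pow_block_start_Suc letter_at_block_start funpow_swap1)

lemma reads_central: "reads (central n) ((block_start ^^ n) x)"
  by (induction n) (simp_all add: reads_sigma_snoc del: reads_append)


section \<open>Words with a given kernel\<close>

lemma fib_steps: "fib (n + 2) = fib (Suc n) + fib n" "fib (n + 3) = fib (n + 2) + fib (Suc n)"
    "fib (n + 4) = fib (n + 3) + fib (n + 2)"
  by (simp_all add: eval_nat_numeral)

text \<open>The position \<open>y\<close> is the one just before a block of level \<open>n + 1\<close>. If the block before it comes
  from \<open>a\<close>, then the next singular word starts at \<open>y\<close>. If it comes from \<open>b\<close>, that \<open>b\<close> ends
  the image \<open>ab\<close> of an \<open>a\<close>. So one level up the preceding block comes from \<open>a\<close>, and the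
  singular word after the next starts at \<open>y\<close>.\<close>

lemma longer_sing_left_of_window:
  assumes "Suc y = (block_start ^^ Suc n) x"
  shows "reads (sing (n + 1)) y \<or> reads (sing (n + 2)) y"
proof -
  have "x \<noteq> 0" using assms by (intro notI) simp
  then obtain z where z: "x = Suc z" by (metis not0_implies_Suc)
  show ?thesis
  proof (cases "letter_at z")
    case La
    then obtain u where "z = block_start u" by (auto simp: letter_at_La_iff)
    with assms z have "reads (sing (Suc n)) y" unfolding reads_sing_iff by blast
    then show ?thesis by simp
  next
    case Lb
    then obtain u where "x = block_start (Suc (block_start u))"
      using z by (metis letter_at_Lb_E)
    then have "Suc y = (block_start ^^ Suc (Suc n)) (Suc (block_start u))"
      using assms by (simp add: funpow_swap1)
    then have "reads (sing (Suc (Suc n))) y" unfolding reads_sing_iff by blast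
    then show ?thesis by simp
  qed
qed

text \<open>Both candidates end at the position \<open>X + fib (n + 4) - 2\<close>, which is the first one to the right of the
  window that begins at \<open>X\<close>. If the block at \<open>X\<close> comes from \<open>a\<close>, it starts a block one level up;
  if it comes from \<open>b\<close>, the block before it starts one two levels up.\<close>

lemma longer_sing_right_of_window:
  fixes n x :: nat
  defines "X \<equiv> (block_start ^^ Suc n) x"
  shows "reads (sing (n + 1)) (X + fib (n + 3) - 1) \<or> reads (sing (n + 2)) (X + fib (n + 2) - 1)"
proof (cases "letter_at x")
  case La
  then obtain u where "x = block_start u" by (auto simp: letter_at_La_iff)
  then have "X + fib (n + 3) = (block_start ^^ Suc n) (Suc (block_start u))"
    using pow_block_start_Suc_La[of "Suc n" u]
    by (simp add: X_def funpow_swap1 eval_nat_numeral del: fib.simps)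
  moreover have "0 < X + fib (n + 3)" by (simp add: fib_neq_0_nat)
  ultimately have "reads (sing (Suc n)) (X + fib (n + 3) - 1)"
    unfolding reads_sing_iff by (metis Suc_pred')
  then show ?thesis by simp
next
  case Lb
  then obtain u where u: "x = Suc (block_start (block_start u))"
    by (auto elim: letter_at_Lb_E)
  have "X = (block_start ^^ Suc (Suc (Suc n))) u + fib (n + 3)"
    using pow_block_start_Suc_La[of "Suc n" "block_start u"]
    by (simp add: X_def u funpow_swap1 eval_nat_numeral del: fib.simps)
  then have "X + fib (n + 2) = (block_start ^^ Suc (Suc (Suc n))) u + fib (Suc (Suc n) + 2)"
    using fib_steps(3)[of n] by (simp add: eval_nat_numeral del: fib.simps)
  also have "\<dots> = (block_start ^^ Suc (Suc n)) (Suc (block_start u))"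
    by (simp only: pow_block_start_Suc_La)
  finally have "X + fib (n + 2) = (block_start ^^ Suc (Suc n)) (Suc (block_start u))" .
  moreover have "0 < X + fib (n + 2)" by (simp add: fib_neq_0_nat)
  ultimately have "reads (sing (Suc (Suc n))) (X + fib (n + 2) - 1)"
    unfolding reads_sing_iff by (metis Suc_pred')
  then show ?thesis by simp
qed

text \<open>This describes the kernel by index instead of length, which avoids the tie between the two singular
  words of length 1.\<close>

definition max_sing :: "nat \<Rightarrow> word \<Rightarrow> bool" where
  "max_sing n w \<longleftrightarrow> sublist (sing n) w \<and> (\<forall>j>n. \<not> sublist (sing j) w)"

lemma ex_max_sing:
  assumes "w \<noteq> []"
  shows "\<exists>n. max_sing n w"
proof -
  let ?J = "{n. sublist (sing n) w}"
  have "sublist [hd w] w"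
    using assms by (cases w) (auto simp: sublist_def intro: exI[of _ "[]"])
  then have "?J \<noteq> {}"
    by (cases "hd w") (auto simp flip: sing_0 sing_1)
  moreover have "n \<le> length w" if "sublist (sing n) w" for n
    using sublist_length_le[OF that] le_fib[of n] by (simp add: length_sing)
  then have "finite ?J" by (intro finite_subset[of ?J "{..length w}"]) auto
  ultimately have "Max ?J \<in> ?J" "\<forall>j>Max ?J. j \<notin> ?J"
    using Max_in[of ?J] Max_ge[of ?J] by (blast, metis not_le)
  then show ?thesis unfolding max_sing_def by blast
qed

text \<open>If the occurrence started before the window or ended after it, then it would reach far enough from its
  copy of \<open>sing n\<close> to contain one of the longer singular words found there, against the maximality
  of \<open>n\<close>. The offset \<open>d\<close> of the kernel in \<open>w\<close> and the offset \<open>c\<close> of \<open>w\<close> in the window add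
  up to the place of the kernel in the window.\<close>

lemma factor_in_window:
  assumes w: "reads w r" and max: "max_sing n w"
  obtains c d x where "r = (block_start ^^ Suc n) x + c" "c + length w \<le> length (central (Suc n))"
    "Suc (c + d) = fib (n + 2)" "reads (sing n) (r + d)" "d + length (sing n) \<le> length w"
proof -
  note fs = fib_steps[of n]
  obtain d where d: "reads (sing n) (r + d)" "d + fib (Suc n) \<le> length w"
    using reads_sublistE[OF w] max unfolding max_sing_def by (metis length_sing)
  then obtain x where "Suc (r + d) = (block_start ^^ n) (Suc (block_start x))"
    unfolding reads_sing_iff by blast
  then have x: "Suc (r + d) = (block_start ^^ Suc n) x + fib (n + 2)"
    by (simp only: pow_block_start_Suc_La)
  define X where "X = (block_start ^^ Suc n) x"
  have rd: "Suc (r + d) = X + fib (n + 2)" using x by (simp add: X_def)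
  have sub: False if "reads (sing j) (r + e)" "e + fib (Suc j) \<le> length w" "j > n" for j e
    using sublist_if_reads[OF w that(1)] that max by (auto simp: max_sing_def length_sing)
  have "X \<le> r"
  proof (rule ccontr)
    assume "\<not> X \<le> r"
    then obtain e where e: "X = Suc (r + e)" by (metis less_natE not_le_imp_less)
    then have "reads (sing (n + 1)) (r + e) \<or> reads (sing (n + 2)) (r + e)"
      by (intro longer_sing_left_of_window[where x = x]) (simp add: X_def)
    moreover have "e + fib (n + 3) \<le> length w" using e rd d(2) fs by linarith
    moreover have "fib (Suc (n + 1)) = fib (n + 2)" "fib (Suc (n + 2)) = fib (n + 3)"
      by (simp_all add: eval_nat_numeral del: fib.simps)
    ultimately show False using sub[of "n + 1" e] sub[of "n + 2" e] fs by auto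
  qed
  then obtain c where c: "r = X + c" by (metis le_iff_add)
  have len: "c + length w + 2 \<le> fib (n + 4)"
  proof (rule ccontr)
    assume long: "\<not> c + length w + 2 \<le> fib (n + 4)"
    have "reads (sing (n + 1)) (X + fib (n + 3) - 1) \<or> reads (sing (n + 2)) (X + fib (n + 2) - 1)"
      unfolding X_def by (rule longer_sing_right_of_window)
    moreover have "X + fib (n + 3) - 1 = r + (d + fib (Suc n))"
      "X + fib (n + 2) - 1 = r + d" using rd fs by linarith+
    moreover have "d + fib (Suc n) + fib (n + 2) \<le> length w" "d + fib (n + 3) \<le> length w"
      using long rd c fs by linarith+
    moreover have "fib (Suc (n + 1)) = fib (n + 2)" "fib (Suc (n + 2)) = fib (n + 3)"
      by (simp_all add: eval_nat_numeral del: fib.simps)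
    ultimately show False using sub[of "n + 1" "d + fib (Suc n)"] sub[of "n + 2" d] by auto
  qed
  have "length (central (Suc n)) + 2 = fib (n + 4)"
    using length_central[of "Suc n"] by (simp add: eval_nat_numeral del: fib.simps)
  then have "c + length w \<le> length (central (Suc n))" using len by linarith
  moreover have "Suc (c + d) = fib (n + 2)" using rd c by linarith
  ultimately show ?thesis
    using c d by (intro that[of x c d]) (simp_all only: X_def length_sing)
qed

text \<open>An occurrence of \<open>w\<close> contains its kernel, which determines the window. Conversely all windows show
  the same word, so \<open>w\<close> occurs in each of them at the same offset.\<close>

lemma occurrences_if_max_sing:
  assumes w: "reads w r" and max: "max_sing n w"
  obtains c where "\<And>y. reads w y \<longleftrightarrow> (\<exists>x. y = (block_start ^^ Suc n) x + c)"
    "length w + 2 \<le> fib (n + 4)"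
proof -
  obtain c e x where c: "r = (block_start ^^ Suc n) x + c" "c + length w \<le> length (central (Suc n))"
    and e: "Suc (c + e) = fib (n + 2)"
    and sing_e: "reads (sing n) (r + e)" "e + length (sing n) \<le> length w"
    using factor_in_window[OF assms] .
  have "reads w y \<longleftrightarrow> (\<exists>x. y = (block_start ^^ Suc n) x + c)" for y
  proof
    assume "reads w y"
    then have "reads (sing n) (y + e)" using reads_window[OF w sing_e] by blast
    then obtain z where "Suc (y + e) = (block_start ^^ n) (Suc (block_start z))"
      unfolding reads_sing_iff by blast
    then have "Suc (y + e) = (block_start ^^ Suc n) z + fib (n + 2)"
      by (simp only: pow_block_start_Suc_La)
    then have "y = (block_start ^^ Suc n) z + c" using e by linarith
    then show "\<exists>x. y = (block_start ^^ Suc n) x + c" by blast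
  next
    assume "\<exists>x. y = (block_start ^^ Suc n) x + c"
    then show "reads w y"
      using reads_window[OF reads_central, of w "Suc n" x c] w c(1,2) reads_central by blast
  qed
  moreover have "length (central (Suc n)) + 2 = fib (n + 4)"
    using length_central[of "Suc n"] by (simp add: eval_nat_numeral del: fib.simps)
  then have "length w + 2 \<le> fib (n + 4)" using c(2) by linarith
  ultimately show ?thesis by (rule that)
qed

lemma fib_less: "i < j \<Longrightarrow> 2 \<le> j \<Longrightarrow> fib (Suc i) < fib (Suc j)"
proof -
  assume ij: "i < j" "2 \<le> j"
  then obtain k where k: "j = Suc (Suc k)" by (metis add_2_eq_Suc le_iff_add)
  have "fib (Suc i) \<le> fib (Suc (Suc k))" using ij k by (intro fib_mono) simp
  also have "\<dots> < fib (Suc j)" by (simp add: k fib_neq_0_nat)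
  finally show ?thesis .
qed

lemma sing_eq_iff: "sing i = sing j \<longleftrightarrow> i = j"
proof -
  have "sing i \<noteq> sing j" if "i < j" for i j
  proof (cases "2 \<le> j")
    case True
    with fib_less[OF that] show ?thesis by (metis length_sing less_irrefl)
  next
    case False
    with that have "i = 0" "j = Suc 0" by auto
    then show ?thesis by (simp add: sing_0 sing_1)
  qed
  then show ?thesis by (metis linorder_neqE_nat)
qed

lemma singular_words_eq: "singular_words = range sing"
proof -
  have "\<exists>n. sing_word k = sing n" if "k \<ge> -1" for k
    using that by (intro exI[of _ "nat (k + 1)"]) (simp add: sing_def)
  then show ?thesis
    by (force simp: singular_words_def sing_def)
qed

lemma reads_if_admissible:
  assumes "w \<in> admissible"
  obtains r where "reads w r"
proof -
  obtain q where q: "occurs_at w q"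
    using assms by (auto simp: admissible_def fib_factors_def)
  moreover from q have "q = Suc (q - 1)" by (simp add: occurs_at_def)
  ultimately have "reads w (q - 1)" by (simp add: reads_def)
  then show ?thesis by (rule that)
qed

text \<open>The kernel has length 1 here, and \<open>a\<close> would compete with \<open>b\<close> for being the longest. The words in
  the window \<open>aba\<close> that contain both letters are \<open>ab\<close>, \<open>ba\<close> and \<open>aba\<close>, which are not admissible.\<close>

lemma admissible_max_sing_1:
  assumes "w \<in> admissible" "max_sing 1 w"
  shows "w = [Lb]"
proof -
  obtain r where r: "reads w r"
    using assms(1) by (rule reads_if_admissible)
  obtain c x where c: "r = (block_start ^^ Suc 1) x + c"
    "c + length w \<le> length (central (Suc 1))"
    using factor_in_window[OF r assms(2)] by metis
  have cen: "central (Suc 1) = [La, Lb, La]" by simp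
  define l where "l = length w"
  have w: "w = take l (drop c [La, Lb, La])"
    using reads_eq_take_drop[OF reads_central[of "Suc 1" x]] r c cen unfolding l_def by metis
  have "c + l \<le> 3" using c(2) by (simp only: cen l_def) simp
  then have "c \<in> {0, 1, 2, 3}" "l \<in> {0, 1, 2, 3}" by auto
  moreover have "w \<notin> {[], [La, Lb], [Lb, La], [La, Lb, La]}"
    using assms(1) by (simp add: admissible_def)
  moreover have "Lb \<in> set w"
    using assms(2) by (auto simp: max_sing_def sing_1 sublist_def)
  ultimately show ?thesis unfolding w by auto
qed

text \<open>Lengths of singular words increase with the index except for the pair \<open>a\<close>, \<open>b\<close>, so a rival of
  the same length could only arise for \<open>n = 1\<close>, where the word is \<open>b\<close> itself.\<close>

lemma sing_kernel_eq:
  assumes "w \<in> admissible" "max_sing n w"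
  shows "sing_kernel w = sing n"
  unfolding sing_kernel_def singular_words_eq
proof (rule the_equality)
  have le: "length u \<le> length (sing n)" if "u \<in> range sing" "sublist u w" for u
    using that assms(2) by (auto simp: max_sing_def length_sing not_less[symmetric] fib_mono)
       (meson fib_mono not_less Suc_le_mono)
  then show "sing n \<in> range sing \<and> sublist (sing n) w \<and>
      (\<forall>u\<in>range sing. sublist u w \<longrightarrow> length u \<le> length (sing n))"
    using assms(2) by (auto simp: max_sing_def)
  fix v
  assume v: "v \<in> range sing \<and> sublist v w \<and>
      (\<forall>u\<in>range sing. sublist u w \<longrightarrow> length u \<le> length v)"
  then obtain j where j: "v = sing j" by blast
  have "j \<le> n" using v j assms(2) by (auto simp: max_sing_def not_less[symmetric])
  have "fib (Suc n) \<le> fib (Suc j)"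
    using v assms(2) by (auto simp: max_sing_def j simp flip: length_sing)
  have "j = n"
  proof (rule ccontr)
    assume "j \<noteq> n"
    with \<open>j \<le> n\<close> \<open>fib (Suc n) \<le> fib (Suc j)\<close> fib_less[of j n] have "n = 1" "j = 0" by linarith+
    with admissible_max_sing_1 assms have "w = [Lb]" by blast
    with v j \<open>j = 0\<close> show False by (auto simp: sing_0 sublist_def Cons_eq_append_conv)
  qed
  with j show "v = sing n" by simp
qed


section \<open>Gaps between consecutive occurrences\<close>

lemma enumerate_range:
  fixes f :: "nat \<Rightarrow> nat"
  assumes "strict_mono f"
  shows "enumerate (range f) n = f n"
proof (induction n)
  case 0
  show ?case
    unfolding enumerate_0 using strict_mono_less_eq[OF assms]
    by (intro Least_equality) auto
next
  case (Suc n)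
  have inf: "infinite (range f)"
    using assms by (simp add: range_inj_infinite strict_mono_imp_inj_on)
  show ?case
    unfolding enumerate_Suc''[OF inf] Suc
    using strict_mono_less_eq[OF assms] strict_mono_less[OF assms]
    by (intro Least_equality) auto
qed

lemma occ_Suc:
  assumes "w \<in> admissible" "max_sing n w" "p \<ge> 1"
  shows "occ w (Suc p) = occ w p + (if fib_seq p = La then fib (n + 3) else fib (n + 2))"
proof -
  obtain r where "reads w r" using assms(1) by (rule reads_if_admissible)
  then obtain c where c: "\<And>y. reads w y \<longleftrightarrow> (\<exists>x. y = (block_start ^^ Suc n) x + c)"
    using occurrences_if_max_sing assms(2) by metis
  let ?f = "\<lambda>x. Suc ((block_start ^^ Suc n) x + c)"
  have "occurs_at w q \<longleftrightarrow> q \<in> range ?f" for q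
  proof (cases q)
    case 0
    then show ?thesis by (auto simp: occurs_at_def)
  next
    case (Suc y)
    then show ?thesis using c[of y] by (auto simp: reads_def)
  qed
  then have "{q. occurs_at w q} = range ?f" by blast
  moreover have "strict_mono ?f"
    using strict_mono_pow_block_start[of "Suc n"] by (simp add: strict_mono_def)
  ultimately have occ: "occ w (Suc x) = ?f x" for x
    by (simp only: occ_def enumerate_range diff_Suc_1)
  obtain x where p: "p = Suc x" using assms(3) by (cases p) auto
  have "(block_start ^^ Suc n) (Suc x) = (block_start ^^ Suc n) x
      + (if fib_seq p = La then fib (n + 3) else fib (n + 2))"
    using pow_block_start_Suc[of "Suc n" x] by (simp only: p letter_at_def) (simp add: eval_nat_numeral)
  then show ?thesis unfolding p occ by simp
qed

lemma overlap_next_iff: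
  assumes "w \<in> admissible" "max_sing n w" "p \<ge> 1"
  shows "occ_positions w p \<inter> occ_positions w (p + 1) \<noteq> {}
    \<longleftrightarrow> fib (n + 3) < length w \<or> fib (n + 2) < length w \<and> fib_seq p = Lb"
proof -
  define g where "g = (if fib_seq p = La then fib (n + 3) else fib (n + 2))"
  have "g > 0" by (simp add: g_def fib_neq_0_nat)
  have "occ_positions w p \<inter> occ_positions w (p + 1) \<noteq> {} \<longleftrightarrow> g < length w"
    using \<open>g > 0\<close> by (simp add: occ_positions_def occ_Suc[OF assms] flip: g_def)
  moreover have "fib (n + 2) \<le> fib (n + 3)" by (intro fib_mono) simp
  ultimately show ?thesis
    by (cases "fib_seq p") (auto simp: g_def simp del: fib.simps)
qed

lemma not_Lb_twice: "p \<ge> 1 \<Longrightarrow> fib_seq p = Lb \<Longrightarrow> fib_seq (p + 1) = La"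
  using no_two_Lb[of "p - 1"] by (simp add: letter_at_def)

section \<open>The spectrum\<close>

lemma fib_len_int: "fib_len (int k) = fib (k + 2)" "fib_len (int k + 1) = fib (k + 3)"
  by (simp_all add: fib_len_def nat_add_distrib add.commute)

text \<open>The kernel fixes the \<open>k\<close> in the definition of the types: it is the index \<open>m\<close> of the kernel plus 2 for
  T1.3 and T2.3, and plus 1 for T2.2, where \<open>m = n - 1\<close>. In T2.3 the upper bound on the length holds
  because the word fits in its window.\<close>

lemma types_iff:
  assumes w: "w \<in> admissible" "max_sing n w"
  shows T1_3_iff: "w \<in> T1 3 \<longleftrightarrow> length w = fib (n + 3)"
    and T2_2_iff: "w \<in> T2 2 \<longleftrightarrow> fib (n + 2) < length w \<and> length w < fib (n + 3)"
    and T2_3_iff: "w \<in> T2 3 \<longleftrightarrow> fib (n + 3) < length w"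
proof -
  have kernel: "i \<ge> -1 \<and> sing_kernel w = sing_word i \<longleftrightarrow> i = int n - 1" for i
  proof
    assume i: "i \<ge> -1 \<and> sing_kernel w = sing_word i"
    then have "sing (nat (i + 1)) = sing n"
      using sing_kernel_eq[OF w] by (simp add: sing_def)
    with i show "i = int n - 1" by (auto simp: sing_eq_iff)
  qed (simp add: sing_kernel_eq[OF w] sing_def)
  obtain r where "reads w r" using w(1) by (rule reads_if_admissible)
  then have bound: "length w + 2 \<le> fib (n + 4)"
    using occurrences_if_max_sing w(2) by metis
  have k3: "int k - int 3 + 1 = int n - 1 \<longleftrightarrow> k = n + 1" for k by auto
  have k2: "int k - int 2 + 1 = int n - 1 \<longleftrightarrow> k = n" for k by auto
  have f: "fib (n + 1 + 2) = fib (n + 3)" "fib (n + 1 + 3) = fib (n + 4)"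
    by (simp_all add: eval_nat_numeral del: fib.simps)
  have lt: "fib (n + 3) < fib (n + 4)"
    using fib_less[of "n + 2" "n + 3"] by (simp add: eval_nat_numeral del: fib.simps)
  show "w \<in> T1 3 \<longleftrightarrow> length w = fib (n + 3)"
    unfolding T1_def mem_Collect_eq kernel k3 fib_len_int using f lt w(1) by auto
  show "w \<in> T2 2 \<longleftrightarrow> fib (n + 2) < length w \<and> length w < fib (n + 3)"
    unfolding T2_def mem_Collect_eq kernel k2 fib_len_int using w(1) by auto
  show "w \<in> T2 3 \<longleftrightarrow> fib (n + 3) < length w"
    unfolding T2_def mem_Collect_eq kernel k3 fib_len_int using f bound w(1) by auto
qed

theorem proposition6p9:
  shows "(spectrum 1 = ((T1 3 \<union> T2 2) \<times> Gamma_b) \<union> (T2 3 \<times> {1..}) \<and>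
          T1 3 \<inter> T2 2 = {} \<and>
          ((T1 3 \<union> T2 2) \<times> Gamma_b) \<inter> (T2 3 \<times> {1..}) = {}) \<and>
         spectrum 2 = T2 3 \<times> {1..} \<and>
         {w \<in> admissible. overlap_inf w} = T2 3"
proof -
  have adm: "w \<in> admissible" if "w \<in> T1 3 \<or> w \<in> T2 2 \<or> w \<in> T2 3" for w
    using that by (auto simp: T1_def T2_def)
  have "\<exists>n. max_sing n w" if "w \<in> admissible" for w
    using that by (intro ex_max_sing) (auto simp: admissible_def)
  then obtain N where N: "max_sing (N w) w" if "w \<in> admissible" for w by metis
  note iffs = T1_3_iff[OF _ N] T2_2_iff[OF _ N] T2_3_iff[OF _ N]
  have next_iff: "occ_positions w p \<inter> occ_positions w (p + 1) \<noteq> {}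
      \<longleftrightarrow> w \<in> T2 3 \<or> (w \<in> T1 3 \<or> w \<in> T2 2) \<and> p \<in> Gamma_b"
    if "w \<in> admissible" "p \<ge> 1" for w p
  proof -
    have "fib (N w + 2) < fib (N w + 3)"
      using fib_less[of "N w + 1" "N w + 2"] by (simp add: eval_nat_numeral del: fib.simps)
    then show ?thesis
      unfolding overlap_next_iff[OF that(1) N[OF that(1)] that(2)]
        iffs[OF that(1) that(1)] using that(2) by (auto simp: Gamma_b_def simp del: fib.simps)
  qed
  have disj: "w \<notin> T2 2 \<and> w \<notin> T2 3" if "w \<in> T1 3" for w
  proof -
    have w: "w \<in> admissible" using that adm by blast
    from that show ?thesis unfolding iffs[OF w w] by linarith
  qed
  have disj': "w \<notin> T2 3" if "w \<in> T2 2" for w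
  proof -
    have w: "w \<in> admissible" using that adm by blast
    from that show ?thesis unfolding iffs[OF w w] by linarith
  qed
  have all: "overlap_occ i w p" if "w \<in> T2 3" "p \<ge> 1" for i w p
    unfolding overlap_occ_def
  proof (intro allI impI)
    fix t
    have "w \<in> admissible" "p + t \<ge> 1" using that adm[of w] by simp_all
    from next_iff[OF this] show "occ_positions w (p + t) \<inter> occ_positions w (p + t + 1) \<noteq> {}"
      using that(1) by blast
  qed
  have two: "w \<in> T2 3" if "w \<in> admissible" "p \<ge> 1" "overlap_occ 2 w p" for w p
  proof (rule ccontr)
    assume "w \<notin> T2 3"
    moreover have "occ_positions w (p + t) \<inter> occ_positions w (p + t + 1) \<noteq> {}" if "t < 2" for t
      using \<open>overlap_occ 2 w p\<close> that by (simp add: overlap_occ_def)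
    from this[of 0] this[of 1]
    have "occ_positions w p \<inter> occ_positions w (p + 1) \<noteq> {}"
      "occ_positions w (p + 1) \<inter> occ_positions w (p + 1 + 1) \<noteq> {}" by simp_all
    ultimately have "p \<in> Gamma_b" "p + 1 \<in> Gamma_b"
      using that next_iff[of w p] next_iff[of w "p + 1"] by auto
    then show False using not_Lb_twice[of p] by (simp add: Gamma_b_def)
  qed
  have "spectrum 1 = ((T1 3 \<union> T2 2) \<times> Gamma_b) \<union> (T2 3 \<times> {1..})"
  proof -
    have "(w, p) \<in> spectrum 1 \<longleftrightarrow> w \<in> admissible \<and> p \<ge> 1
        \<and> (w \<in> T2 3 \<or> (w \<in> T1 3 \<or> w \<in> T2 2) \<and> p \<in> Gamma_b)" for w p
      using next_iff[of w p] by (auto simp: spectrum_def overlap_occ_def)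
    moreover have "p \<ge> 1" if "p \<in> Gamma_b" for p using that by (simp add: Gamma_b_def)
    ultimately show ?thesis using adm by auto
  qed
  moreover have "T1 3 \<inter> T2 2 = {}" using disj by blast
  moreover have "((T1 3 \<union> T2 2) \<times> Gamma_b) \<inter> (T2 3 \<times> {1..}) = {}" using disj disj' by blast
  moreover have "spectrum 2 = T2 3 \<times> {1..}"
    using all two adm by (auto simp: spectrum_def)
  moreover have "{w \<in> admissible. overlap_inf w} = T2 3"
  proof (intro equalityI subsetI)
    fix w
    assume w: "w \<in> {w \<in> admissible. overlap_inf w}"
    then have "overlap 2 w" by (simp add: overlap_inf_def)
    with w two show "w \<in> T2 3" by (auto simp: overlap_def)
  next
    fix w
    assume "w \<in> T2 3"
    with all adm show "w \<in> {w \<in> admissible. overlap_inf w}"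
      by (auto simp: overlap_inf_def overlap_def)
  qed
  ultimately show ?thesis by blast
qed

end
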